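(* Let $\Xi=\{0,1\}$. Let $\Delta_{out}$ be a fixed integer value between $0$ and $\Delta$. Let $G,H$ be disjoint subgraphs of the grid such that $|H|=\Delta_{out}$ and $G$ is a connected component with the same value $x_{i,j}$ for every $(i,j)\in G$ and with minimum cut ratio $$\rho:=\min_{U\subset G,\ 0<|U|\le\Delta_r}\frac{|\partial U|}{|U|},\qquad \Delta_r:=\Delta-\Delta_{out}.$$ Every feasible point $(d,\delta,\beta,\gamma)$ of (IP) which fulfills $\sum_{(i,j)\in H}\delta_{i,j}=\Delta_{out}$ also fulfills the inequality $$0\le-\rho\sum_{(i,j)\in G}\delta_{i,j}+\sum_{((i,j),(i+1,j))\in G\times G}\beta_{i,j}+\sum_{((i,j),(i,j+1))\in G\times G}\gamma_{i,j}.$$ For a constant $\bar M$ sufficiently large, the inequality $$0\le-\rho\sum_{(i,j)\in G}\delta_{i,j}+\sum_{((i,j),(i+1,j))\in G\times G}\beta_{i,j}+\sum_{((i,j),(i,j+1))\in G\times G}\gamma_{i,j}+\bar M\Bigl(\Delta_{out}-\sum_{(i,j)\in H}\delta_{i,j}\Bigr)$$ holds for every feasible point of (IP).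
   Context: Setting: $N,M\in\mathbb{N}$, $[N]:=\{1,\dots,N\}$, $x\in\Xi^{N\times M}$, $c\in\mathbb{R}^{N\times M}$, $\alpha>0$, $\Delta\in\mathbb{N}$. (IP): minimize $\sum_{i=1}^N\sum_{j=1}^M c_{i,j}d_{i,j}+\alpha\bigl(\sum_{j=1}^M\sum_{i=1}^{N-1}\beta_{i,j}+\sum_{i=1}^N\sum_{j=1}^{M-1}\gamma_{i,j}\bigr)$ over $d\in\mathbb{Z}^{N\times M}$, $\delta\in\mathbb{R}^{N\times M}$, $\beta\in\mathbb{R}^{(N-1)\times M}$, $\gamma\in\mathbb{R}^{N\times(M-1)}$ subject to - $\min\Xi\le x_{i,j}+d_{i,j}\le\max\Xi$ for $i\in[N],j\in[M]$; - $-\beta_{i,j}\le x_{i+1,j}+d_{i+1,j}-x_{i,j}-d_{i,j}\le\beta_{i,j}$ for $i\in[N-1],j\in[M]$; - $-\gamma_{i,j}\le x_{i,j+1}+d_{i,j+1}-x_{i,j}-d_{i,j}\le\gamma_{i,j}$ for $i\in[N],j\in[M-1]$; - $-\delta_{i,j}\le d_{i,j}\le\delta_{i,j}$ for $i\in[N],j\in[M]$; - $\sum_{i=1}^N\sum_{j=1}^M\delta_{i,j}\le\Delta$. The grid is the graph with node set $[N]\times[M]$ in which two nodes are joined by an edge if they differ by exactly one in exactly one coordinate and agree in the other. Subgraphs are identified with their node sets (with all grid edges between their nodes), and $|\cdot|$ is the number of nodes of a subgraph or the number of edges of an edge set. That $G$ is a connected component means here that it is a connected subgraph of the grid. For $U\subset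 G$, $\partial U$ is the set of edges of the subgraph $G$ with one endpoint in $U$ and the other in $G\setminus U$. The sums over $((i,j),(i+1,j))\in G\times G$ and $((i,j),(i,j+1))\in G\times G$ run over all such pairs with both nodes in $G$.
   Formalization: The claims fail when δ exceeds |d| (e.g. d=β=γ=0, x constant, δ positive on G), so the formal statement assumes δ=|d| on G in the first claim and on G and H in the second. *)

theory Defs
  imports Complex_Main
begin

text \<open>An \<open>N \<times> M\<close> matrix is a function \<open>nat \<Rightarrow> nat \<Rightarrow> _\<close> read at the indices
  \<open>1..N\<close>, \<open>1..M\<close> only. A subgraph of the grid is identified with its node set.\<close>

definition grid :: "nat \<Rightarrow> nat \<Rightarrow> (nat \<times> nat) set" where
  "grid N M = {1..N} \<times> {1..M}"

definition grid_adj :: "nat \<times> nat \<Rightarrow> nat \<times> nat \<Rightarrow> bool" where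
  "grid_adj u v \<longleftrightarrow>
     (snd u = snd v \<and> (fst v = fst u + 1 \<or> fst u = fst v + 1)) \<or>
     (fst u = fst v \<and> (snd v = snd u + 1 \<or> snd u = snd v + 1))"

definition grid_connected :: "(nat \<times> nat) set \<Rightarrow> bool" where
  "grid_connected G \<longleftrightarrow>
     (\<forall>u\<in>G. \<forall>v\<in>G. (u, v) \<in> {(a, b). a \<in> G \<and> b \<in> G \<and> grid_adj a b}\<^sup>*)"

text \<open>Edges are undirected, hence two-element node sets.\<close>

definition edge_boundary ::
  "(nat \<times> nat) set \<Rightarrow> (nat \<times> nat) set \<Rightarrow> (nat \<times> nat) set set" where
  "edge_boundary G U = {{u, v} | u v. u \<in> U \<and> v \<in> G - U \<and> grid_adj u v}"

text \<open>The subset \<open>U = G\<close> is allowed. The value is meaningful only for \<open>G \<noteq> {}\<close>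
  and \<open>k > 0\<close>; otherwise it is the unspecified real \<open>Min {}\<close>.\<close>

definition min_cut_ratio :: "(nat \<times> nat) set \<Rightarrow> nat \<Rightarrow> real" where
  "min_cut_ratio G k =
     Min {real (card (edge_boundary G U)) / real (card U) | U.
            U \<subseteq> G \<and> 0 < card U \<and> card U \<le> k}"

text \<open>The constraints of the integer program; its objective plays no role for feasibility.\<close>

definition ip_feasible ::
  "int set \<Rightarrow> nat \<Rightarrow> nat \<Rightarrow> nat \<Rightarrow> (nat \<Rightarrow> nat \<Rightarrow> int) \<Rightarrow> (nat \<Rightarrow> nat \<Rightarrow> int) \<Rightarrow>
   (nat \<Rightarrow> nat \<Rightarrow> real) \<Rightarrow> (nat \<Rightarrow> nat \<Rightarrow> real) \<Rightarrow> (nat \<Rightarrow> nat \<Rightarrow> real) \<Rightarrow> bool" where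
  "ip_feasible \<Xi> N M \<Delta> x d \<delta> \<beta> \<gamma> \<longleftrightarrow>
     (\<forall>i\<in>{1..N}. \<forall>j\<in>{1..M}. Min \<Xi> \<le> x i j + d i j \<and> x i j + d i j \<le> Max \<Xi>) \<and>
     (\<forall>i\<in>{1..N-1}. \<forall>j\<in>{1..M}.
        - \<beta> i j \<le> real_of_int (x (i+1) j + d (i+1) j - x i j - d i j) \<and>
        real_of_int (x (i+1) j + d (i+1) j - x i j - d i j) \<le> \<beta> i j) \<and>
     (\<forall>i\<in>{1..N}. \<forall>j\<in>{1..M-1}.
        - \<gamma> i j \<le> real_of_int (x i (j+1) + d i (j+1) - x i j - d i j) \<and>
        real_of_int (x i (j+1) + d i (j+1) - x i j - d i j) \<le> \<gamma> i j) \<and>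
     (\<forall>i\<in>{1..N}. \<forall>j\<in>{1..M}.
        - \<delta> i j \<le> real_of_int (d i j) \<and> real_of_int (d i j) \<le> \<delta> i j) \<and>
     (\<Sum>i=1..N. \<Sum>j=1..M. \<delta> i j) \<le> real \<Delta>"

text \<open>The constraints only force \<open>\<bar>d i j\<bar> \<le> \<delta> i j\<close>. The auxiliary variable \<open>\<delta>\<close> stands
  for \<open>\<bar>d\<bar>\<close>, and the cut inequalities fail for feasible points where \<open>\<delta>\<close> has slack:
  with \<open>d = 0\<close>, \<open>x\<close> constant and \<open>\<beta> = \<gamma> = 0\<close>, \<open>\<delta>\<close> may still be positive on \<open>G\<close>.\<close>

definition delta_exact_on ::
  "(nat \<times> nat) set \<Rightarrow> (nat \<Rightarrow> nat \<Rightarrow> int) \<Rightarrow> (nat \<Rightarrow> nat \<Rightarrow> real) \<Rightarrow> bool" where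
  "delta_exact_on A d \<delta> \<longleftrightarrow> (\<forall>(i, j)\<in>A. \<delta> i j = real_of_int \<bar>d i j\<bar>)"

end

theory Submission
  imports Defs
begin

text \<open>Where \<open>x\<close> is constant on \<open>G\<close>, binary values leave each node of \<open>G\<close> only two options:
  keep its value or flip it. So \<open>d\<close> restricted to \<open>G\<close> is described by the set \<open>U\<close> of flipped
  nodes, and with \<open>\<delta> = \<bar>d\<bar>\<close> the sum of \<open>\<delta>\<close> over \<open>G\<close> is \<open>\<bar>U\<bar>\<close>. A grid edge inside \<open>G\<close>
  sees a jump of the new values exactly when it belongs to \<open>\<partial>U\<close>; its variable \<open>\<beta>\<close> or \<open>\<gamma>\<close> is
  then at least \<open>1\<close>, and it is nonnegative in any case. Hence the \<open>\<beta>\<close> and \<open>\<gamma>\<close> sums dominate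
  \<open>\<bar>\<partial>U\<bar>\<close> (\<open>boundary_of_flips_le_jump_costs\<close>). When \<open>H\<close> uses up \<open>\<Delta>out\<close> of the budget,
  \<open>\<bar>U\<bar> \<le> \<Delta> - \<Delta>out\<close>, so \<open>U\<close> competes in the minimum that defines \<open>\<rho>\<close> and
  \<open>\<rho> \<bar>U\<bar> \<le> \<bar>\<partial>U\<bar>\<close> (\<open>min_cut_ratio_mult_card_le\<close>); this is the first inequality.

  For the second one, the sum of \<open>\<delta>\<close> over \<open>H\<close> is the number of flips in \<open>H\<close>, an integer
  that is at most \<open>\<bar>H\<bar> = \<Delta>out\<close>. Either it equals \<open>\<Delta>out\<close>, and the first inequality
  applies, or the factor of \<open>Mbar\<close> is at least \<open>1\<close>, and \<open>Mbar \<ge> \<bar>\<rho>\<bar> \<bar>G\<bar>\<close> outweighs the only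
  term that can be negative.\<close>

section \<open>Edge boundaries and the cut ratio\<close>

text \<open>The sums run over the lower endpoint of each edge in \<open>G\<close>, the form in which edges index
  \<open>\<beta>\<close> and \<open>\<gamma>\<close>. An undirected boundary edge arises from such an endpoint whose successor in one
  coordinate lies on the other side of the cut.\<close>

lemma card_edge_boundary_le_crossings:
  assumes fin: "finite G" and U: "U \<subseteq> G"
  shows "real (card (edge_boundary G U)) \<le>
    (\<Sum>(i, j)\<in>{(i, j). (i, j) \<in> G \<and> (i+1, j) \<in> G}. of_bool (((i, j) \<in> U) \<noteq> ((i+1, j) \<in> U))) +
    (\<Sum>(i, j)\<in>{(i, j). (i, j) \<in> G \<and> (i, j+1) \<in> G}. of_bool (((i, j) \<in> U) \<noteq> ((i, j+1) \<in> U)))"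
    (is "_ \<le> (\<Sum>(i, j)\<in>?V. ?v i j) + (\<Sum>(i, j)\<in>?W. ?w i j)")
proof -
  let ?V' = "{(i, j). (i, j) \<in> ?V \<and> ((i, j) \<in> U) \<noteq> ((i+1, j) \<in> U)}"
  let ?W' = "{(i, j). (i, j) \<in> ?W \<and> ((i, j) \<in> U) \<noteq> ((i, j+1) \<in> U)}"
  have V: "finite ?V" and W: "finite ?W"
    by (rule finite_subset[OF _ fin]; auto)+
  have V': "finite ?V'" and W': "finite ?W'"
    by (rule finite_subset[OF _ fin]; auto)+
  have "edge_boundary G U \<subseteq>
      (\<lambda>(i, j). {(i, j), (i+1, j)}) ` ?V' \<union> (\<lambda>(i, j). {(i, j), (i, j+1)}) ` ?W'"
    (is "_ \<subseteq> ?f ` _ \<union> ?g ` _")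
  proof
    fix e assume "e \<in> edge_boundary G U"
    then obtain a b a' b' where e: "e = {(a, b), (a', b')}"
      and u: "(a, b) \<in> U" and v: "(a', b') \<in> G" "(a', b') \<notin> U"
      and adj: "grid_adj (a, b) (a', b')"
      unfolding edge_boundary_def by auto
    have uG: "(a, b) \<in> G" using u U by auto
    from adj consider "b' = b" "a' = a + 1" | "b' = b" "a = a' + 1"
      | "a' = a" "b' = b + 1" | "a' = a" "b = b' + 1"
      unfolding grid_adj_def by auto
    then show "e \<in> ?f ` ?V' \<union> ?g ` ?W'"
    proof cases
      case 1
      then have "(a, b) \<in> ?V'" "e = ?f (a, b)" using e u v uG by auto
      then show ?thesis by blast
    next
      case 2
      then have "(a', b') \<in> ?V'" "e = ?f (a', b')" using e u v uG by auto
      then show ?thesis by blast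
    next
      case 3
      then have "(a, b) \<in> ?W'" "e = ?g (a, b)" using e u v uG by auto
      then show ?thesis by blast
    next
      case 4
      then have "(a', b') \<in> ?W'" "e = ?g (a', b')" using e u v uG by auto
      then show ?thesis by blast
    qed
  qed
  then have "card (edge_boundary G U) \<le> card (?f ` ?V' \<union> ?g ` ?W')"
    using V' W' by (intro card_mono) auto
  also have "\<dots> \<le> card (?f ` ?V') + card (?g ` ?W')"
    by (rule card_Un_le)
  also have "\<dots> \<le> card ?V' + card ?W'"
    using V' W' by (intro add_mono card_image_le)
  finally have "real (card (edge_boundary G U)) \<le> real (card ?V') + real (card ?W')"
    by linarith
  also have "real (card ?V') = (\<Sum>(i, j)\<in>?V. ?v i j)"
  proof -
    have "?V' = ?V \<inter> {p. ((fst p, snd p) \<in> U) \<noteq> ((fst p + 1, snd p) \<in> U)}" by auto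
    with V show ?thesis by (simp add: case_prod_unfold)
  qed
  also have "real (card ?W') = (\<Sum>(i, j)\<in>?W. ?w i j)"
  proof -
    have "?W' = ?W \<inter> {p. ((fst p, snd p) \<in> U) \<noteq> ((fst p, snd p + 1) \<in> U)}" by auto
    with W show ?thesis by (simp add: case_prod_unfold)
  qed
  finally show ?thesis .
qed

text \<open>In this multiplied form the bound covers \<open>U = {}\<close>, which the minimum excludes: both sides
  are then \<open>0\<close>, whatever the value of the ratio.\<close>

lemma min_cut_ratio_mult_card_le:
  assumes fin: "finite G" and U: "U \<subseteq> G" and k: "card U \<le> k"
  shows "min_cut_ratio G k * real (card U) \<le> real (card (edge_boundary G U))"
proof (cases "card U = 0")
  case False
  let ?R = "{real (card (edge_boundary G U)) / real (card U) | U.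
               U \<subseteq> G \<and> 0 < card U \<and> card U \<le> k}"
  have "finite ?R"
    by (rule finite_subset[of _ "(\<lambda>U. real (card (edge_boundary G U)) / real (card U)) ` Pow G"])
      (use fin in auto)
  moreover have "real (card (edge_boundary G U)) / real (card U) \<in> ?R"
    using False U k by auto
  ultimately have "min_cut_ratio G k \<le> real (card (edge_boundary G U)) / real (card U)"
    unfolding min_cut_ratio_def by (rule Min_le)
  with False show ?thesis by (simp add: pos_le_divide_eq)
qed simp

section \<open>Feasible points\<close>

lemma finite_subset_grid:
  assumes "A \<subseteq> grid N M"
  shows "finite A"
  using assms unfolding grid_def by (rule finite_subset) simp

lemma ip_feasible_delta_nonneg:
  assumes "ip_feasible \<Xi> N M \<Delta> x d \<delta> \<beta> \<gamma>" and "(i, j) \<in> grid N M"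
  shows "0 \<le> \<delta> i j"
proof -
  have "- \<delta> i j \<le> real_of_int (d i j) \<and> real_of_int (d i j) \<le> \<delta> i j"
    using assms unfolding ip_feasible_def grid_def by auto
  then show ?thesis by linarith
qed

lemma ip_feasible_budget:
  assumes feas: "ip_feasible \<Xi> N M \<Delta> x d \<delta> \<beta> \<gamma>" and A: "A \<subseteq> grid N M"
  shows "(\<Sum>(i, j)\<in>A. \<delta> i j) \<le> real \<Delta>"
proof -
  have "(\<Sum>(i, j)\<in>A. \<delta> i j) \<le> (\<Sum>(i, j)\<in>grid N M. \<delta> i j)"
    using ip_feasible_delta_nonneg[OF feas] A
    by (intro sum_mono2) (auto intro: finite_subset_grid)
  also have "\<dots> = (\<Sum>i=1..N. \<Sum>j=1..M. \<delta> i j)"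
    unfolding grid_def by (simp add: sum.cartesian_product)
  also have "\<dots> \<le> real \<Delta>"
    using feas unfolding ip_feasible_def by blast
  finally show ?thesis .
qed

text \<open>A binary value can change by at most \<open>1\<close>, so an exact \<open>\<delta>\<close> is the indicator of the
  flipped nodes and its sum counts them.\<close>

lemma sum_delta_eq_card_flips:
  assumes feas: "ip_feasible {0, 1} N M \<Delta> x d \<delta> \<beta> \<gamma>"
    and x: "\<forall>i\<in>{1..N}. \<forall>j\<in>{1..M}. x i j \<in> {0, 1}"
    and A: "A \<subseteq> grid N M" and exact: "delta_exact_on A d \<delta>"
  shows "(\<Sum>(i, j)\<in>A. \<delta> i j) = real (card {(i, j). (i, j) \<in> A \<and> d i j \<noteq> 0})"
proof -
  have "\<delta> i j = of_bool (d i j \<noteq> 0)" if ij: "(i, j) \<in> A" for i j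
  proof -
    have g: "i \<in> {1..N}" "j \<in> {1..M}" using ij A unfolding grid_def by auto
    have "0 \<le> x i j + d i j" "x i j + d i j \<le> 1"
      using feas g unfolding ip_feasible_def by auto
    moreover have "x i j = 0 \<or> x i j = 1" using x g by auto
    ultimately have "\<bar>d i j\<bar> = of_bool (d i j \<noteq> 0)" by auto
    moreover have "\<delta> i j = real_of_int \<bar>d i j\<bar>"
      using exact ij unfolding delta_exact_on_def by auto
    ultimately show ?thesis by simp
  qed
  then have "(\<Sum>(i, j)\<in>A. \<delta> i j) = (\<Sum>(i, j)\<in>A. of_bool (d i j \<noteq> 0))"
    by (intro sum.cong) auto
  also have "\<dots> = real (card (A \<inter> {p. d (fst p) (snd p) \<noteq> 0}))"
    using finite_subset_grid[OF A] by (simp add: case_prod_unfold)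
  also have "A \<inter> {p. d (fst p) (snd p) \<noteq> 0} = {(i, j). (i, j) \<in> A \<and> d i j \<noteq> 0}"
    by auto
  finally show ?thesis .
qed

lemma ip_feasible_beta_ge_jump:
  assumes "ip_feasible \<Xi> N M \<Delta> x d \<delta> \<beta> \<gamma>"
    and "(i, j) \<in> grid N M" and "(i+1, j) \<in> grid N M"
  shows "\<bar>real_of_int (x (i+1) j + d (i+1) j - x i j - d i j)\<bar> \<le> \<beta> i j"
proof -
  have "i \<in> {1..N-1}" "j \<in> {1..M}" using assms(2,3) unfolding grid_def by auto
  then have "- \<beta> i j \<le> real_of_int (x (i+1) j + d (i+1) j - x i j - d i j) \<and>
      real_of_int (x (i+1) j + d (i+1) j - x i j - d i j) \<le> \<beta> i j"
    using assms(1) unfolding ip_feasible_def by blast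
  then show ?thesis by linarith
qed

lemma ip_feasible_gamma_ge_jump:
  assumes "ip_feasible \<Xi> N M \<Delta> x d \<delta> \<beta> \<gamma>"
    and "(i, j) \<in> grid N M" and "(i, j+1) \<in> grid N M"
  shows "\<bar>real_of_int (x i (j+1) + d i (j+1) - x i j - d i j)\<bar> \<le> \<gamma> i j"
proof -
  have "i \<in> {1..N}" "j \<in> {1..M-1}" using assms(2,3) unfolding grid_def by auto
  then have "- \<gamma> i j \<le> real_of_int (x i (j+1) + d i (j+1) - x i j - d i j) \<and>
      real_of_int (x i (j+1) + d i (j+1) - x i j - d i j) \<le> \<gamma> i j"
    using assms(1) unfolding ip_feasible_def by blast
  then show ?thesis by linarith
qed

text \<open>Between two nodes with the same \<open>x\<close> the jump is a difference of two values of \<open>d\<close>.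
  If exactly one of them is \<open>0\<close>, integrality makes the jump at least \<open>1\<close>.\<close>

lemma boundary_of_flips_le_jump_costs:
  assumes feas: "ip_feasible \<Xi> N M \<Delta> x d \<delta> \<beta> \<gamma>"
    and G: "G \<subseteq> grid N M"
    and const: "\<forall>(i, j)\<in>G. \<forall>(k, l)\<in>G. x i j = x k l"
  shows "real (card (edge_boundary G {(i, j). (i, j) \<in> G \<and> d i j \<noteq> 0})) \<le>
      (\<Sum>(i, j)\<in>{(i, j). (i, j) \<in> G \<and> (i+1, j) \<in> G}. \<beta> i j) +
      (\<Sum>(i, j)\<in>{(i, j). (i, j) \<in> G \<and> (i, j+1) \<in> G}. \<gamma> i j)"
    (is "real (card (edge_boundary G ?U)) \<le> _")
proof -
  have jump: "of_bool (((i, j) \<in> ?U) \<noteq> ((k, l) \<in> ?U)) \<le>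
      \<bar>real_of_int (x k l + d k l - x i j - d i j)\<bar>"
    if "(i, j) \<in> G" "(k, l) \<in> G" for i j k l
  proof -
    have "x i j = x k l" using const that by blast
    then have "of_bool (((i, j) \<in> ?U) \<noteq> ((k, l) \<in> ?U)) \<le>
        \<bar>x k l + d k l - x i j - d i j\<bar>" using that by auto
    then show ?thesis by (auto simp: of_bool_def split: if_splits)
  qed
  have beta: "of_bool (((i, j) \<in> ?U) \<noteq> ((i+1, j) \<in> ?U)) \<le> \<beta> i j"
    if "(i, j) \<in> G" "(i+1, j) \<in> G" for i j
    by (rule order_trans[OF jump[OF that] ip_feasible_beta_ge_jump[OF feas]])
      (use that G in blast)+
  have gamma: "of_bool (((i, j) \<in> ?U) \<noteq> ((i, j+1) \<in> ?U)) \<le> \<gamma> i j"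
    if "(i, j) \<in> G" "(i, j+1) \<in> G" for i j
    by (rule order_trans[OF jump[OF that] ip_feasible_gamma_ge_jump[OF feas]])
      (use that G in blast)+
  have "?U \<subseteq> G" by auto
  note card_edge_boundary_le_crossings[OF finite_subset_grid[OF G] this]
  also have "(\<Sum>(i, j)\<in>{(i, j). (i, j) \<in> G \<and> (i+1, j) \<in> G}.
        of_bool (((i, j) \<in> ?U) \<noteq> ((i+1, j) \<in> ?U))) +
      (\<Sum>(i, j)\<in>{(i, j). (i, j) \<in> G \<and> (i, j+1) \<in> G}.
        of_bool (((i, j) \<in> ?U) \<noteq> ((i, j+1) \<in> ?U))) \<le>
      (\<Sum>(i, j)\<in>{(i, j). (i, j) \<in> G \<and> (i+1, j) \<in> G}. \<beta> i j) +
      (\<Sum>(i, j)\<in>{(i, j). (i, j) \<in> G \<and> (i, j+1) \<in> G}. \<gamma> i j)"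
    using beta gamma by (intro add_mono sum_mono) (auto simp only: mem_Collect_eq split: prod.splits)
  finally show ?thesis .
qed

section \<open>The cut inequalities\<close>

theorem theorem7:
  fixes N M \<Delta> \<Delta>out :: nat
    and \<Xi> :: "int set"
    and x :: "nat \<Rightarrow> nat \<Rightarrow> int"
    and G H :: "(nat \<times> nat) set"
    and \<rho> :: real
  assumes "\<Xi> = {0, 1}"
    and "\<forall>i\<in>{1..N}. \<forall>j\<in>{1..M}. x i j \<in> \<Xi>"
    and "\<Delta>out \<le> \<Delta>"
    and "G \<subseteq> grid N M" and "H \<subseteq> grid N M" and "G \<inter> H = {}"
    and "card H = \<Delta>out"
    and "grid_connected G"
    and "\<forall>(i, j)\<in>G. \<forall>(k, l)\<in>G. x i j = x k l"
    and "\<rho> = min_cut_ratio G (\<Delta> - \<Delta>out)"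
  shows "(\<forall>d \<delta> \<beta> \<gamma>.
            ip_feasible \<Xi> N M \<Delta> x d \<delta> \<beta> \<gamma> \<and> delta_exact_on G d \<delta> \<and>
            (\<Sum>(i, j)\<in>H. \<delta> i j) = real \<Delta>out \<longrightarrow>
            0 \<le> - \<rho> * (\<Sum>(i, j)\<in>G. \<delta> i j)
                 + (\<Sum>(i, j)\<in>{(i, j). (i, j) \<in> G \<and> (i+1, j) \<in> G}. \<beta> i j)
                 + (\<Sum>(i, j)\<in>{(i, j). (i, j) \<in> G \<and> (i, j+1) \<in> G}. \<gamma> i j)) \<and>
         (\<exists>M0 :: real. \<forall>Mbar \<ge> M0. \<forall>d \<delta> \<beta> \<gamma>.
            ip_feasible \<Xi> N M \<Delta> x d \<delta> \<beta> \<gamma> \<and> delta_exact_on (G \<union> H) d \<delta> \<longrightarrow>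
            0 \<le> - \<rho> * (\<Sum>(i, j)\<in>G. \<delta> i j)
                 + (\<Sum>(i, j)\<in>{(i, j). (i, j) \<in> G \<and> (i+1, j) \<in> G}. \<beta> i j)
                 + (\<Sum>(i, j)\<in>{(i, j). (i, j) \<in> G \<and> (i, j+1) \<in> G}. \<gamma> i j)
                 + Mbar * (real \<Delta>out - (\<Sum>(i, j)\<in>H. \<delta> i j)))"
proof -
  note x = assms(2)[unfolded assms(1)] and G = assms(4) and H = assms(5) and const = assms(9)
  let ?B = "\<lambda>\<beta> :: nat \<Rightarrow> nat \<Rightarrow> real. \<Sum>(i, j)\<in>{(i, j). (i, j) \<in> G \<and> (i+1, j) \<in> G}. \<beta> i j"
  let ?C = "\<lambda>\<gamma> :: nat \<Rightarrow> nat \<Rightarrow> real. \<Sum>(i, j)\<in>{(i, j). (i, j) \<in> G \<and> (i, j+1) \<in> G}. \<gamma> i j"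
  have fG: "finite G" and fH: "finite H"
    using G H by (auto intro: finite_subset_grid)

  have tight: "0 \<le> - \<rho> * (\<Sum>(i, j)\<in>G. \<delta> i j) + ?B \<beta> + ?C \<gamma>"
    if "ip_feasible \<Xi> N M \<Delta> x d \<delta> \<beta> \<gamma>" and exact: "delta_exact_on G d \<delta>"
      and sumH: "(\<Sum>(i, j)\<in>H. \<delta> i j) = real \<Delta>out" for d \<delta> \<beta> \<gamma>
  proof -
    have feas: "ip_feasible {0, 1} N M \<Delta> x d \<delta> \<beta> \<gamma>" using that(1) assms(1) by simp
    let ?U = "{(i, j). (i, j) \<in> G \<and> d i j \<noteq> 0}"
    have sumG: "(\<Sum>(i, j)\<in>G. \<delta> i j) = real (card ?U)"
      by (rule sum_delta_eq_card_flips[OF feas x G exact])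
    have "(\<Sum>(i, j)\<in>G. \<delta> i j) + (\<Sum>(i, j)\<in>H. \<delta> i j) = (\<Sum>(i, j)\<in>G \<union> H. \<delta> i j)"
      using fG fH assms(6) by (simp add: sum.union_disjoint)
    also have "\<dots> \<le> real \<Delta>"
      using G H by (intro ip_feasible_budget[OF feas]) simp
    finally have "card ?U \<le> \<Delta> - \<Delta>out" using sumG sumH by linarith
    then have "\<rho> * real (card ?U) \<le> real (card (edge_boundary G ?U))"
      unfolding assms(10) by (intro min_cut_ratio_mult_card_le fG) auto
    also have "\<dots> \<le> ?B \<beta> + ?C \<gamma>"
      by (rule boundary_of_flips_le_jump_costs[OF feas G const])
    finally show ?thesis using sumG by simp
  qed

  have relaxed: "0 \<le> - \<rho> * (\<Sum>(i, j)\<in>G. \<delta> i j) + ?B \<beta> + ?C \<gamma>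
        + Mbar * (real \<Delta>out - (\<Sum>(i, j)\<in>H. \<delta> i j))"
    if Mbar: "\<bar>\<rho>\<bar> * real (card G) \<le> Mbar"
      and feas': "ip_feasible \<Xi> N M \<Delta> x d \<delta> \<beta> \<gamma>" and exact: "delta_exact_on (G \<union> H) d \<delta>"
    for Mbar d \<delta> \<beta> \<gamma>
  proof -
    have feas: "ip_feasible {0, 1} N M \<Delta> x d \<delta> \<beta> \<gamma>" using feas' assms(1) by simp
    have exG: "delta_exact_on G d \<delta>" and exH: "delta_exact_on H d \<delta>"
      using exact unfolding delta_exact_on_def by auto
    let ?U = "{(i, j). (i, j) \<in> G \<and> d i j \<noteq> 0}"
    let ?F = "{(i, j). (i, j) \<in> H \<and> d i j \<noteq> 0}"
    have sumG: "(\<Sum>(i, j)\<in>G. \<delta> i j) = real (card ?U)"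
      by (rule sum_delta_eq_card_flips[OF feas x G exG])
    have sumH: "(\<Sum>(i, j)\<in>H. \<delta> i j) = real (card ?F)"
      by (rule sum_delta_eq_card_flips[OF feas x H exH])
    have "card ?F \<le> card H" using fH by (intro card_mono) auto
    then consider "card ?F = \<Delta>out" | "card ?F + 1 \<le> \<Delta>out"
      using assms(7) by linarith
    then show ?thesis
    proof cases
      case 1
      then show ?thesis using tight[OF feas' exG] sumH by simp
    next
      case 2
      have "card ?U \<le> card G" using fG by (intro card_mono) auto
      then have "\<rho> * real (card ?U) \<le> \<bar>\<rho>\<bar> * real (card G)"
        by (intro mult_mono) auto
      moreover have "0 \<le> Mbar" using Mbar by (rule order_trans[rotated]) simp
      then have "Mbar * 1 \<le> Mbar * (real \<Delta>out - real (card ?F))"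
        using 2 by (intro mult_left_mono) linarith+
      moreover have "0 \<le> ?B \<beta> + ?C \<gamma>"
        using boundary_of_flips_le_jump_costs[OF feas G const] by linarith
      ultimately show ?thesis using Mbar sumG sumH by simp
    qed
  qed
  show ?thesis
    using tight relaxed by blast
qed

end
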